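(* Let $G$ be an equiregular group of homeomorphisms of a topological space $X$ such that the orbit space $G\backslash X$ is a paracompact regular space. Then every $G$-invariant open cover of $X$ is star-refined by a $G$-invariant open cover of $X$.
   Context: $G\backslash X$ denotes the orbit space with the quotient topology. Paracompact means that every open cover has a locally finite open refinement (Hausdorffness is NOT part of the definition). Regular means: for every point $x$ and every open neighborhood $U$ of $x$ there is an open neighborhood $V$ of $x$ with $\mathrm{cl}(V)\subset U$ (no further separation axiom is included). $G$ is equiregular if for every $x\in X$ and every open neighborhood $U$ of $x$ in $X$ there is an open neighborhood $V$ of $x$ in $X$ such that $\mathrm{cl}(V)\subset U$ and every $y\in X$ has an open neighborhood $N_y$ with the property that for every $g\in G$, if $g(N_y)\cap\mathrm{cl}(V)\ne\emptyset$, then $g(N_y)\subset U$. An open cover $\mathcal{U}$ of $X$ is $G$-invariant if $g(U)\in\mathcal{U}$ for every $U\in\mathcal{U}$ and $g\in G$. For $x\in X$, $\mathrm{Star}(x,\mathcal{V})=\bigcup\{V\in\mathcal{V}:x\in V\}$. An open cover $\mathcal{V}$ star-refines an open cover $\mathcal{U}$ if $\{\mathrm{Star}(x,\mathcal{V}):x\in X\}$ refines $\mathcal{U}$, i.e. each $\mathrm{Star}(x,\mathcal{V})$ is contained in some element of $\mathcal{U}$. *)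

theory Defs
  imports "HOL-Analysis.Analysis" "HOL-Algebra.Group_Action"
begin

text \<open>
  Elements of \<open>G\<close> are taken extensional (\<open>undefined\<close> outside \<^term>\<open>topspace X\<close>), as in
  \<^const>\<open>BijGroup\<close>, so that equality in \<open>G\<close> is equality of maps on the space.
\<close>
definition homeomorphism_group :: "'a topology \<Rightarrow> ('a \<Rightarrow> 'a) set \<Rightarrow> bool" where
  "homeomorphism_group X G \<longleftrightarrow>
     subgroup G (BijGroup (topspace X)) \<and> (\<forall>g\<in>G. homeomorphic_map X X g)"

abbreviation homeo_orbit :: "'a topology \<Rightarrow> ('a \<Rightarrow> 'a) set \<Rightarrow> 'a \<Rightarrow> 'a set" where
  "homeo_orbit X G \<equiv> orbit ((BijGroup (topspace X))\<lparr>carrier := G\<rparr>) (\<lambda>g. g)"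

abbreviation homeo_orbits :: "'a topology \<Rightarrow> ('a \<Rightarrow> 'a) set \<Rightarrow> 'a set set" where
  "homeo_orbits X G \<equiv> orbits ((BijGroup (topspace X))\<lparr>carrier := G\<rparr>) (topspace X) (\<lambda>g. g)"

definition orbit_space :: "'a topology \<Rightarrow> ('a \<Rightarrow> 'a) set \<Rightarrow> 'a set topology" where
  "orbit_space X G =
     topology (\<lambda>W. W \<subseteq> homeo_orbits X G \<and> openin X {x \<in> topspace X. homeo_orbit X G x \<in> W})"

lemma openin_orbit_space:
  "openin (orbit_space X G) W \<longleftrightarrow>
     W \<subseteq> homeo_orbits X G \<and> openin X {x \<in> topspace X. homeo_orbit X G x \<in> W}"
proof -
  let ?P = "\<lambda>x W. homeo_orbit X G x \<in> W"
  have "istopology (\<lambda>W. W \<subseteq> homeo_orbits X G \<and> openin X {x \<in> topspace X. ?P x W})"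
    unfolding istopology_def
  proof (intro conjI allI impI)
    fix S T
    assume "S \<subseteq> homeo_orbits X G \<and> openin X {x \<in> topspace X. ?P x S}"
      and "T \<subseteq> homeo_orbits X G \<and> openin X {x \<in> topspace X. ?P x T}"
    moreover have "{x \<in> topspace X. ?P x (S \<inter> T)} =
        {x \<in> topspace X. ?P x S} \<inter> {x \<in> topspace X. ?P x T}" by blast
    ultimately show "openin X {x \<in> topspace X. ?P x (S \<inter> T)}" by auto
  next
    fix \<K>
    assume \<K>: "\<forall>K\<in>\<K>. K \<subseteq> homeo_orbits X G \<and> openin X {x \<in> topspace X. ?P x K}"
    have "{x \<in> topspace X. ?P x (\<Union>\<K>)} = (\<Union>K\<in>\<K>. {x \<in> topspace X. ?P x K})" by blast
    with \<K> show "openin X {x \<in> topspace X. ?P x (\<Union>\<K>)}" by auto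
  qed blast+
  then show ?thesis by (simp add: orbit_space_def)
qed

lemma topspace_orbit_space: "topspace (orbit_space X G) = homeo_orbits X G"
proof
  show "topspace (orbit_space X G) \<subseteq> homeo_orbits X G"
    using openin_topspace[of "orbit_space X G"] unfolding openin_orbit_space by blast
  have "{x \<in> topspace X. homeo_orbit X G x \<in> homeo_orbits X G} = topspace X"
    by (auto simp: orbits_def)
  then have "openin (orbit_space X G) (homeo_orbits X G)"
    by (simp add: openin_orbit_space)
  then show "homeo_orbits X G \<subseteq> topspace (orbit_space X G)"
    by (rule openin_subset)
qed

lemma quotient_map_orbit_space: "quotient_map X (orbit_space X G) (homeo_orbit X G)"
  unfolding quotient_map_def topspace_orbit_space openin_orbit_space
  by (auto simp: orbits_def)

definition open_cover :: "'a topology \<Rightarrow> 'a set set \<Rightarrow> bool" where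
  "open_cover X \<U> \<longleftrightarrow> (\<forall>U\<in>\<U>. openin X U) \<and> \<Union>\<U> = topspace X"

text \<open>No separation axiom is included.\<close>
definition paracompact_space :: "'a topology \<Rightarrow> bool" where
  "paracompact_space X \<longleftrightarrow>
     (\<forall>\<U>. open_cover X \<U> \<longrightarrow>
       (\<exists>\<V>. open_cover X \<V> \<and> (\<forall>V\<in>\<V>. \<exists>U\<in>\<U>. V \<subseteq> U) \<and> locally_finite_in X \<V>))"

text \<open>
  The library's \<^const>\<open>regular_space\<close>, which includes no T1 or Hausdorff axiom, in its
  neighbourhood form.
\<close>
lemma regular_space_iff_closure_of:
  "regular_space X \<longleftrightarrow>
     (\<forall>x\<in>topspace X. \<forall>U. openin X U \<and> x \<in> U \<longrightarrow>
       (\<exists>V. openin X V \<and> x \<in> V \<and> X closure_of V \<subseteq> U))"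
proof (intro iffI ballI allI impI)
  fix x U
  assume "regular_space X" "openin X U \<and> x \<in> U"
  then obtain V C where VC: "openin X V" "closedin X C" "x \<in> V" "V \<subseteq> C" "C \<subseteq> U"
    unfolding neighbourhood_base_of_closedin[symmetric] neighbourhood_base_of by meson
  then have "X closure_of V \<subseteq> U"
    using closure_of_minimal by blast
  with VC show "\<exists>V. openin X V \<and> x \<in> V \<and> X closure_of V \<subseteq> U" by blast
next
  assume R: "\<forall>x\<in>topspace X. \<forall>U. openin X U \<and> x \<in> U \<longrightarrow>
       (\<exists>V. openin X V \<and> x \<in> V \<and> X closure_of V \<subseteq> U)"
  show "regular_space X"
    unfolding neighbourhood_base_of_closedin[symmetric] neighbourhood_base_of
  proof (intro allI impI)
    fix W x
    assume W: "openin X W \<and> x \<in> W"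
    then have "x \<in> topspace X" using openin_subset by blast
    with R W obtain V where V: "openin X V" "x \<in> V" "X closure_of V \<subseteq> W" by blast
    moreover have "V \<subseteq> X closure_of V"
      using V(1) by (simp add: closure_of_subset openin_subset)
    ultimately show "\<exists>U V. openin X U \<and> closedin X V \<and> x \<in> U \<and> U \<subseteq> V \<and> V \<subseteq> W"
      using closedin_closure_of by blast
  qed
qed

definition equiregular :: "'a topology \<Rightarrow> ('a \<Rightarrow> 'a) set \<Rightarrow> bool" where
  "equiregular X G \<longleftrightarrow>
     (\<forall>x\<in>topspace X. \<forall>U. openin X U \<and> x \<in> U \<longrightarrow>
       (\<exists>V. openin X V \<and> x \<in> V \<and> X closure_of V \<subseteq> U \<and>
         (\<forall>y\<in>topspace X. \<exists>N. openin X N \<and> y \<in> N \<and>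
           (\<forall>g\<in>G. g ` N \<inter> X closure_of V \<noteq> {} \<longrightarrow> g ` N \<subseteq> U))))"

definition invariant_family :: "('a \<Rightarrow> 'a) set \<Rightarrow> 'a set set \<Rightarrow> bool" where
  "invariant_family G \<U> \<longleftrightarrow> (\<forall>U\<in>\<U>. \<forall>g\<in>G. g ` U \<in> \<U>)"

definition Star :: "'a \<Rightarrow> 'a set set \<Rightarrow> 'a set" where
  "Star x \<V> = \<Union>{V \<in> \<V>. x \<in> V}"

definition star_refines :: "'a topology \<Rightarrow> 'a set set \<Rightarrow> 'a set set \<Rightarrow> bool" where
  "star_refines X \<V> \<U> \<longleftrightarrow> (\<forall>x\<in>topspace X. \<exists>U\<in>\<U>. Star x \<V> \<subseteq> U)"

end

theory Submission
  imports Defs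
begin

text \<open>
  For each point choose a member of the cover around it and, by equiregularity, an open set inside
  that member. The orbit projection is open, so the images of these open sets cover the orbit space;
  take a locally finite refinement there. Each point \<open>y\<close> then has to satisfy the equiregularity
  condition only for the finitely many refining sets near its orbit, so one neighbourhood \<open>N y\<close>
  works for all of them. The translates of the \<open>N y\<close> form the required cover: whichever
  translates contain a given \<open>x\<close>, the same refining set, and hence the same translate of a member
  of the cover, contains them all.
\<close>

section \<open>Group elements as maps on the space\<close>

lemma homeomorphism_group_one:
  assumes "homeomorphism_group X G"
  obtains e where "e \<in> G" "\<And>x. x \<in> topspace X \<Longrightarrow> e x = x"
proof -
  have "\<one>\<^bsub>BijGroup (topspace X)\<^esub> \<in> G"
    using assms unfolding homeomorphism_group_def by (blast intro: subgroup.one_closed)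
  then show thesis
    by (rule that) (simp add: BijGroup_def)
qed

text \<open>A product in \<open>BijGroup\<close> is restricted to the carrier, so it is guaranteed
  to agree with the composite only on the space. Hence the form of the conclusion: an element of
  \<open>G\<close> with an equation at the points of \<open>topspace X\<close>.\<close>

lemma homeomorphism_group_mult:
  assumes "homeomorphism_group X G" "g \<in> G" "h \<in> G"
  obtains k where "k \<in> G" "\<And>x. x \<in> topspace X \<Longrightarrow> k x = g (h x)"
proof -
  have G: "subgroup G (BijGroup (topspace X))"
    using assms(1) by (simp add: homeomorphism_group_def)
  have gh: "g \<in> Bij (topspace X)" "h \<in> Bij (topspace X)"
    using subgroup.subset[OF G] assms by (auto simp: BijGroup_def)
  have "g \<otimes>\<^bsub>BijGroup (topspace X)\<^esub> h \<in> G"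
    using subgroup.m_closed[OF G] assms by blast
  then show thesis
    by (rule that) (use gh in \<open>simp add: BijGroup_def compose_def\<close>)
qed

lemma homeomorphism_group_inv:
  assumes "homeomorphism_group X G" "g \<in> G"
  obtains k where "k \<in> G" "\<And>x. x \<in> topspace X \<Longrightarrow> k (g x) = x"
proof -
  have G: "subgroup G (BijGroup (topspace X))"
    using assms(1) by (simp add: homeomorphism_group_def)
  have g: "g \<in> Bij (topspace X)"
    using subgroup.subset[OF G] assms by (auto simp: BijGroup_def)
  have inj: "inj_on g (topspace X)" and im: "g ` topspace X = topspace X"
    using g by (auto simp: Bij_def bij_betw_def)
  have "inv\<^bsub>BijGroup (topspace X)\<^esub> g \<in> G"
    using subgroup.m_inv_closed[OF G] assms G by (simp add: subgroup.subset group_BijGroup)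
  then have "restrict (inv_into (topspace X) g) (topspace X) \<in> G"
    using g by (simp add: inv_BijGroup)
  then show thesis
    by (rule that) (use inj im in auto)
qed

lemma homeomorphism_group_homeomorphic_map:
  "homeomorphism_group X G \<Longrightarrow> g \<in> G \<Longrightarrow> homeomorphic_map X X g"
  by (simp add: homeomorphism_group_def)

lemma homeomorphism_group_in_topspace:
  assumes "homeomorphism_group X G" "g \<in> G" "x \<in> topspace X"
  shows "g x \<in> topspace X"
  using homeomorphic_imp_surjective_map[OF homeomorphism_group_homeomorphic_map] assms by blast

lemma homeomorphism_group_openin_image:
  assumes "homeomorphism_group X G" "g \<in> G" "openin X U"
  shows "openin X (g ` U)"
  using assms homeomorphism_group_homeomorphic_map homeomorphic_imp_open_map
  unfolding open_map_def by blast

section \<open>Orbits and the projection onto the orbit space\<close>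

lemma in_homeo_orbit_iff: "y \<in> homeo_orbit X G x \<longleftrightarrow> (\<exists>g\<in>G. y = g x)"
  by (auto simp: orbit_def)

text \<open>The identity puts \<open>y\<close> into its own orbit, hence into that of
  \<open>x\<close>.\<close>

lemma homeo_orbit_eq_imp_translate:
  assumes "homeomorphism_group X G" "y \<in> topspace X" "homeo_orbit X G x = homeo_orbit X G y"
  shows "\<exists>g\<in>G. g x = y"
proof -
  obtain e where "e \<in> G" "e y = y"
    using homeomorphism_group_one[OF assms(1)] assms(2) by metis
  then have "y \<in> homeo_orbit X G y"
    unfolding in_homeo_orbit_iff by metis
  then show ?thesis
    unfolding assms(3)[symmetric] in_homeo_orbit_iff by metis
qed

text \<open>Closure under products gives one inclusion; the same inclusion for an inverse of
  \<open>g\<close> at the point \<open>g x\<close> gives the other.\<close>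

lemma homeo_orbit_translate:
  assumes "homeomorphism_group X G" "g \<in> G" "x \<in> topspace X"
  shows "homeo_orbit X G (g x) = homeo_orbit X G x"
proof -
  have sub: "homeo_orbit X G (h y) \<subseteq> homeo_orbit X G y"
    if hy: "h \<in> G" "y \<in> topspace X" for h y
  proof
    fix z assume "z \<in> homeo_orbit X G (h y)"
    then obtain k where k: "k \<in> G" "z = k (h y)"
      unfolding in_homeo_orbit_iff by blast
    obtain l where "l \<in> G" "\<And>w. w \<in> topspace X \<Longrightarrow> l w = k (h w)"
      using homeomorphism_group_mult[OF assms(1) k(1) hy(1)] by metis
    with k hy show "z \<in> homeo_orbit X G y"
      unfolding in_homeo_orbit_iff by metis
  qed
  obtain k where "k \<in> G" "k (g x) = x"
    using homeomorphism_group_inv[OF assms(1,2)] assms(3) by metis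
  then show ?thesis
    using sub[of k "g x"] sub[of g x] homeomorphism_group_in_topspace[OF assms] assms(2,3)
    by (metis subset_antisym)
qed

text \<open>The preimage of the image of \<open>U\<close> is the union of the translates of
  \<open>U\<close>, and these are open because the group elements are homeomorphisms.\<close>

lemma open_map_homeo_orbit:
  assumes "homeomorphism_group X G"
  shows "open_map X (orbit_space X G) (homeo_orbit X G)"
  unfolding open_map_def openin_orbit_space
proof (intro allI impI conjI)
  fix U assume U: "openin X U"
  then have UX: "U \<subseteq> topspace X"
    by (rule openin_subset)
  then show "homeo_orbit X G ` U \<subseteq> homeo_orbits X G"
    by (auto simp: orbits_def)
  have "{x \<in> topspace X. homeo_orbit X G x \<in> homeo_orbit X G ` U} = (\<Union>g\<in>G. g ` U)"
  proof (intro subset_antisym subsetI)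
    fix x assume "x \<in> {x \<in> topspace X. homeo_orbit X G x \<in> homeo_orbit X G ` U}"
    then obtain u where "u \<in> U" "x \<in> topspace X" "homeo_orbit X G u = homeo_orbit X G x"
      by auto
    with homeo_orbit_eq_imp_translate[OF assms] show "x \<in> (\<Union>g\<in>G. g ` U)"
      by blast
  next
    fix x assume "x \<in> (\<Union>g\<in>G. g ` U)"
    then obtain g u where gu: "g \<in> G" "u \<in> U" "x = g u"
      by blast
    with UX homeo_orbit_translate[OF assms, of g u] homeomorphism_group_in_topspace[OF assms]
    show "x \<in> {x \<in> topspace X. homeo_orbit X G x \<in> homeo_orbit X G ` U}"
      by auto
  qed
  with U homeomorphism_group_openin_image[OF assms]
  show "openin X {x \<in> topspace X. homeo_orbit X G x \<in> homeo_orbit X G ` U}"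
    by auto
qed

section \<open>Covers by translates, and common neighbourhoods\<close>

lemma translates_open_cover:
  assumes G: "homeomorphism_group X G"
    and N: "\<And>y. y \<in> topspace X \<Longrightarrow> openin X (N y) \<and> y \<in> N y"
  shows "open_cover X {g ` N y |g y. g \<in> G \<and> y \<in> topspace X}"
proof -
  obtain e where e: "e \<in> G" "\<And>x. x \<in> topspace X \<Longrightarrow> e x = x"
    using homeomorphism_group_one[OF G] by metis
  have op: "openin X V" if "V \<in> {g ` N y |g y. g \<in> G \<and> y \<in> topspace X}" for V
    using that N homeomorphism_group_openin_image[OF G] by auto
  moreover have "topspace X \<subseteq> \<Union>{g ` N y |g y. g \<in> G \<and> y \<in> topspace X}"
  proof
    fix y assume y: "y \<in> topspace X"
    then have "y \<in> e ` N y"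
      using e N by (metis imageI)
    with y e show "y \<in> \<Union>{g ` N y |g y. g \<in> G \<and> y \<in> topspace X}"
      by blast
  qed
  ultimately show ?thesis
    unfolding open_cover_def by (meson Union_least openin_subset subset_antisym)
qed

text \<open>A translate of a translate is the image under one element representing the product. That
  element matches the composite only on the space, so each \<open>N y\<close> has to lie
  there.\<close>

lemma translates_invariant_family:
  assumes G: "homeomorphism_group X G"
    and N: "\<And>y. y \<in> topspace X \<Longrightarrow> N y \<subseteq> topspace X"
  shows "invariant_family G {g ` N y |g y. g \<in> G \<and> y \<in> topspace X}"
  unfolding invariant_family_def
proof (intro ballI)
  fix V h assume "V \<in> {g ` N y |g y. g \<in> G \<and> y \<in> topspace X}" and h: "h \<in> G"
  then obtain g y where V: "V = g ` N y" "g \<in> G" "y \<in> topspace X"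
    by blast
  obtain k where k: "k \<in> G" "\<And>x. x \<in> topspace X \<Longrightarrow> k x = h (g x)"
    using homeomorphism_group_mult[OF G h V(2)] by metis
  have "h ` V = k ` N y"
    unfolding V image_image using k N[OF V(3)] by (intro image_cong) auto
  with k V show "h ` V \<in> {g ` N y |g y. g \<in> G \<and> y \<in> topspace X}"
    by blast
qed

text \<open>Since \<open>P i\<close> passes to subsets, the finitely many neighbourhoods can be
  intersected. The set \<open>S\<close> starts the induction and later keeps \<open>N\<close> over a
  chosen open set of orbits.\<close>

lemma finite_openin_Inter_nbhd:
  assumes "finite I" "openin X S" "y \<in> S"
    and "\<And>i. i \<in> I \<Longrightarrow> \<exists>N. openin X N \<and> y \<in> N \<and> P i N"
    and mono: "\<And>i N N'. P i N \<Longrightarrow> N' \<subseteq> N \<Longrightarrow> P i N'"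
  shows "\<exists>N. openin X N \<and> y \<in> N \<and> N \<subseteq> S \<and> (\<forall>i\<in>I. P i N)"
  using assms(1,4)
proof (induction I rule: finite_induct)
  case empty
  then show ?case using assms(2,3) by blast
next
  case (insert i I)
  then obtain N M where "openin X N" "y \<in> N" "N \<subseteq> S" "\<forall>i\<in>I. P i N"
    and "openin X M" "y \<in> M" "P i M"
    by (metis insertCI)
  then show ?case
    using mono[of _ _ "N \<inter> M"] by (intro exI[of _ "N \<inter> M"]) auto
qed

section \<open>Construction of the star refinement\<close>

theorem lemma5p1:
  fixes X :: "'a topology" and G :: "('a \<Rightarrow> 'a) set"
  assumes "homeomorphism_group X G"
    and "equiregular X G"
    and "paracompact_space (orbit_space X G)"
    and "regular_space (orbit_space X G)"
  shows "\<forall>\<U>. open_cover X \<U> \<and> invariant_family G \<U> \<longrightarrow>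
           (\<exists>\<V>. open_cover X \<V> \<and> invariant_family G \<V> \<and> star_refines X \<V> \<U>)"
proof (intro allI impI, elim conjE)
  fix \<U> assume cover: "open_cover X \<U>" and inv: "invariant_family G \<U>"
  note G = assms(1)
  let ?Q = "orbit_space X G" and ?p = "homeo_orbit X G"
  \<comment> \<open>This is the condition on \<open>N\<close> in equiregularity, with
    \<open>V\<close> in the place of its closure. The condition for the closure implies it, as a
    translate that meets \<open>V\<close> meets the closure.\<close>
  define P where "P U V N \<longleftrightarrow> (\<forall>g\<in>G. g ` N \<inter> V \<noteq> {} \<longrightarrow> g ` N \<subseteq> U)" for U V N :: "'a set"
  have mono: "P U V N \<Longrightarrow> N' \<subseteq> N \<Longrightarrow> P U V N'" for U V N N'
    unfolding P_def by blast
  have "\<exists>U V. U \<in> \<U> \<and> openin X V \<and> x \<in> V \<and>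
      (\<forall>y\<in>topspace X. \<exists>N. openin X N \<and> y \<in> N \<and> P U V N)" if x: "x \<in> topspace X" for x
  proof -
    obtain U where U: "U \<in> \<U>" "openin X U" "x \<in> U"
      using cover x unfolding open_cover_def by blast
    have "\<exists>V. openin X V \<and> x \<in> V \<and> X closure_of V \<subseteq> U \<and>
        (\<forall>y\<in>topspace X. \<exists>N. openin X N \<and> y \<in> N \<and> P U (X closure_of V) N)"
      using assms(2)[unfolded equiregular_def, rule_format, OF x conjI, OF U(2,3)]
      unfolding P_def .
    then obtain V where V: "openin X V" "x \<in> V"
        "\<forall>y\<in>topspace X. \<exists>N. openin X N \<and> y \<in> N \<and> P U (X closure_of V) N"
      by (elim exE conjE)
    have "V \<subseteq> X closure_of V"
      using V(1) by (simp add: closure_of_subset openin_subset)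
    then have "P U (X closure_of V) N \<Longrightarrow> P U V N" for N
      unfolding P_def by blast
    with V(3) have "\<forall>y\<in>topspace X. \<exists>N. openin X N \<and> y \<in> N \<and> P U V N"
      by meson
    with U(1) V(1,2) show ?thesis by blast
  qed
  then obtain U V where UV: "\<And>x. x \<in> topspace X \<Longrightarrow> U x \<in> \<U> \<and> openin X (V x) \<and> x \<in> V x \<and>
      (\<forall>y\<in>topspace X. \<exists>N. openin X N \<and> y \<in> N \<and> P (U x) (V x) N)"
    by metis
  have "open_cover ?Q ((\<lambda>x. ?p ` V x) ` topspace X)"
  proof -
    have op: "openin ?Q (?p ` V x)" if "x \<in> topspace X" for x
      using open_map_homeo_orbit[OF G] UV[OF that] unfolding open_map_def by blast
    moreover have "topspace ?Q \<subseteq> (\<Union>x\<in>topspace X. ?p ` V x)"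
      using UV unfolding topspace_orbit_space by (auto simp: orbits_def)
    ultimately show ?thesis
      unfolding open_cover_def by (auto dest: openin_subset)
  qed
  from assms(3)[unfolded paracompact_space_def, rule_format, OF this]
  obtain \<W> where \<W>: "open_cover ?Q \<W>" "\<forall>W\<in>\<W>. \<exists>x\<in>topspace X. W \<subseteq> ?p ` V x"
      "locally_finite_in ?Q \<W>"
    unfolding bex_simps by (elim exE conjE)
  \<comment> \<open>\<open>c W\<close> is a point whose set \<open>V (c W)\<close> projects onto a
    superset of \<open>W\<close>; it attaches a pair \<open>U (c W)\<close>, \<open>V (c W)\<close>
    to each refining set.\<close>
  from \<W>(2) obtain c where c: "\<And>W. W \<in> \<W> \<Longrightarrow> c W \<in> topspace X \<and> W \<subseteq> ?p ` V (c W)"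
    unfolding Bex_def by (metis (no_types))
  \<comment> \<open>Local finiteness leaves finitely many \<open>W\<close> that meet a neighbourhood
    \<open>O'\<close> of the orbit of \<open>y\<close>. If \<open>N\<close> lies over
    \<open>O'\<close>, any \<open>W\<close> that meets the projection of \<open>N\<close> is among
    these.\<close>
  have "\<exists>N. openin X N \<and> y \<in> N \<and> (\<forall>W\<in>\<W>. W \<inter> ?p ` N \<noteq> {} \<longrightarrow> P (U (c W)) (V (c W)) N)"
    if y: "y \<in> topspace X" for y
  proof -
    have "?p y \<in> topspace ?Q"
      using y unfolding topspace_orbit_space by (auto simp: orbits_def)
    with \<W>(3) have "\<exists>O'. openin ?Q O' \<and> ?p y \<in> O' \<and> finite {W \<in> \<W>. W \<inter> O' \<noteq> {}}"
      unfolding locally_finite_in_def by blast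
    then obtain O' where O: "openin ?Q O'" "?p y \<in> O'" "finite {W \<in> \<W>. W \<inter> O' \<noteq> {}}"
      by (elim exE conjE)
    have "openin X {x \<in> topspace X. ?p x \<in> O'}"
      using O(1) by (simp add: openin_orbit_space)
    moreover have "y \<in> {x \<in> topspace X. ?p x \<in> O'}"
      using y O(2) by simp
    moreover have "\<exists>N. openin X N \<and> y \<in> N \<and> P (U (c W)) (V (c W)) N"
      if "W \<in> {W \<in> \<W>. W \<inter> O' \<noteq> {}}" for W
      using that UV[of "c W"] c[of W] y by simp
    ultimately have "\<exists>N. openin X N \<and> y \<in> N \<and> N \<subseteq> {x \<in> topspace X. ?p x \<in> O'} \<and>
        (\<forall>W\<in>{W \<in> \<W>. W \<inter> O' \<noteq> {}}. P (U (c W)) (V (c W)) N)"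
      by (rule finite_openin_Inter_nbhd[OF O(3),
            where P = "\<lambda>W. P (U (c W)) (V (c W))"]) (assumption, rule mono)
    then obtain N where N: "openin X N" "y \<in> N" "N \<subseteq> {x \<in> topspace X. ?p x \<in> O'}"
      "\<forall>W\<in>{W \<in> \<W>. W \<inter> O' \<noteq> {}}. P (U (c W)) (V (c W)) N"
      by (elim exE conjE)
    from N(3) have "W \<inter> O' \<noteq> {}" if "W \<inter> ?p ` N \<noteq> {}" for W
      using that by blast
    with N(4) have "\<forall>W\<in>\<W>. W \<inter> ?p ` N \<noteq> {} \<longrightarrow> P (U (c W)) (V (c W)) N"
      by simp
    with N(1,2) show ?thesis by (intro exI conjI)
  qed
  then have "\<forall>y\<in>topspace X. \<exists>N. openin X N \<and> y \<in> N \<and>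
      (\<forall>W\<in>\<W>. W \<inter> ?p ` N \<noteq> {} \<longrightarrow> P (U (c W)) (V (c W)) N)"
    by (rule ballI)
  from bchoice[OF this]
  obtain N where "\<forall>y\<in>topspace X. openin X (N y) \<and> y \<in> N y \<and>
      (\<forall>W\<in>\<W>. W \<inter> ?p ` N y \<noteq> {} \<longrightarrow> P (U (c W)) (V (c W)) (N y))"
    by (elim exE)
  note N = bspec[OF this]
  have NX: "N y \<subseteq> topspace X" if "y \<in> topspace X" for y
    using N[OF that] by (simp add: openin_subset)
  let ?\<V> = "{g ` N y |g y. g \<in> G \<and> y \<in> topspace X}"
  have "star_refines X ?\<V> \<U>"
    unfolding star_refines_def
  proof
    fix x assume x: "x \<in> topspace X"
    have "?p x \<in> topspace ?Q"
      using x unfolding topspace_orbit_space by (auto simp: orbits_def)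
    then obtain W where W: "W \<in> \<W>" "?p x \<in> W"
      using \<W>(1) unfolding open_cover_def by blast
    with c obtain v where v: "v \<in> V (c W)" "?p x = ?p v"
      by blast
    have "v \<in> topspace X"
      using v(1) UV[of "c W"] c[OF W(1)] openin_subset by blast
    then obtain h where h: "h \<in> G" "h x = v"
      using homeo_orbit_eq_imp_translate[OF G] v(2) by metis
    obtain k where k: "k \<in> G" "\<And>z. z \<in> topspace X \<Longrightarrow> k (h z) = z"
      using homeomorphism_group_inv[OF G h(1)] by metis
    have "Star x ?\<V> \<subseteq> k ` U (c W)"
    proof
      fix z assume "z \<in> Star x ?\<V>"
      then obtain g y where gy: "g \<in> G" "y \<in> topspace X" "x \<in> g ` N y" "z \<in> g ` N y"
        unfolding Star_def by blast
      obtain n m where n: "n \<in> N y" "x = g n" and m: "m \<in> N y" "z = g m"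
        using gy by blast
      have nm: "n \<in> topspace X" "m \<in> topspace X"
        using n m NX gy by auto
      \<comment> \<open>The point \<open>n\<close> of \<open>N y\<close> shares the orbit of
        \<open>x\<close>, which belongs to \<open>W\<close>. So \<open>W\<close> meets the
        projection of \<open>N y\<close>, and \<open>N y\<close> was chosen to satisfy
        \<open>P\<close> for such \<open>W\<close>.\<close>
      have "?p n = ?p x"
        using homeo_orbit_translate[OF G gy(1) nm(1)] n by simp
      then have "W \<inter> ?p ` N y \<noteq> {}"
        using W n by (metis disjoint_iff imageI)
      then have P: "P (U (c W)) (V (c W)) (N y)"
        using N[OF gy(2)] W(1) by blast
      \<comment> \<open>The translate by \<open>l\<close>, which acts as \<open>g\<close> followed
        by \<open>h\<close>, sends \<open>n\<close> to \<open>v\<close> in \<open>V (c W)\<close>.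
        By \<open>P\<close> it sends all of \<open>N y\<close> into \<open>U (c W)\<close>, and
        \<open>k\<close> carries \<open>l m\<close> back to \<open>z\<close>.\<close>
      obtain l where l: "l \<in> G" "\<And>w. w \<in> topspace X \<Longrightarrow> l w = h (g w)"
        using homeomorphism_group_mult[OF G h(1) gy(1)] by metis
      have "l n = v"
        using l(2)[OF nm(1)] n h by simp
      then have "l ` N y \<inter> V (c W) \<noteq> {}"
        using v(1) n(1) by blast
      then have "l m \<in> U (c W)"
        using P l(1) m(1) unfolding P_def by blast
      moreover have "k (l m) = z"
        using l(2)[OF nm(2)] k(2) m homeomorphism_group_in_topspace[OF G gy(1) nm(2)] by simp
      ultimately show "z \<in> k ` U (c W)"
        by blast
    qed
    \<comment> \<open>Here the invariance of the given cover enters.\<close>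
    moreover have "k ` U (c W) \<in> \<U>"
      using inv k(1) UV c[OF W(1)] unfolding invariant_family_def by blast
    ultimately show "\<exists>U\<in>\<U>. Star x ?\<V> \<subseteq> U"
      by blast
  qed
  then show "\<exists>\<V>. open_cover X \<V> \<and> invariant_family G \<V> \<and> star_refines X \<V> \<U>"
    using translates_open_cover[OF G, of N] translates_invariant_family[OF G, of N] N NX by blast
qed

end
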